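(* Let $r\in\mathbb{N}$, $\mathbf{m}=(m_1,\dots,m_r)\in\mathbb{N}^r$, $m=m_1+\cdots+m_r$, $\mathbf{f}\in\mathbb{C}^r$, $a,b,c,d,e,g\in\mathbb{C}$, $n\in\mathbb{N}$, and put $\lambda=c-a-b-m$. Suppose that $(1+a+b-c)_m\ne0$, $(c-a-m)_m\ne0$, $(c-b-m)_m\ne0$ and $g+e+n-d+\lambda=1$. Then $$ F\left(\begin{matrix}-n,a,b,d,\mathbf{f}+\mathbf{m}\\c,g,e,\mathbf{f}\end{matrix}\right) =\frac{(g+\lambda)_n(e+\lambda)_n}{(g)_n(e)_n}\,F\left(\begin{matrix}-n,\;a+\lambda,\;b+\lambda,\;d,\;\hat{\boldsymbol\zeta}+1\\c,\;g+\lambda,\;e+\lambda,\;\hat{\boldsymbol\zeta}\end{matrix}\right), $$ where $\hat{\boldsymbol\zeta}=(\zeta_1,\dots,\zeta_m)$ is the vector of zeros of the polynomial $\hat{Q}_m(a,b,c,\mathbf{f},\mathbf{m};t)$ (defined in the context). The hypergeometric functions on both sides are Saalschützian, i.e. the sum of the lower parameters minus the sum of the upper parameters equals $1$.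
   Context: Notation: $(a)_n=\Gamma(a+n)/\Gamma(a)$; for vectors $(\mathbf{a})_n=\prod_j(a_j)_n$, and $\mathbf{a}+\beta$ means adding $\beta$ to each component. $F\left(\begin{smallmatrix}\mathbf{a}\\\mathbf{b}\end{smallmatrix}\right)=\sum_{k\ge0}\frac{(\mathbf{a})_k}{(\mathbf{b})_k k!}$ is the generalized hypergeometric series at unit argument. Standing convention: lower parameters are never non-positive integers. $$ \hat{Q}_m(a,b,c,\mathbf{f},\mathbf{m};t)=\sum_{k=0}^{m}\frac{{}_{r+1}F_{r}(-k,\mathbf{f}+\mathbf{m};\mathbf{f}\,|\,1)\,(a)_k(b)_k(t)_k}{(c-a-m)_k(c-b-m)_k\,k!}\;{}_{3}F_{2}\left(\begin{matrix}-m+k,\;t+k,\;c-a-b-m\\c-a-m+k,\;c-b-m+k\end{matrix}\,\Big|\,1\right). $$ Zeros are listed with multiplicity; as implicit in the notation $(\zeta_1,\dots,\zeta_m)$, $\hat{Q}_m$ is taken to have exact degree $m$. *)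

theory Defs
  imports "HOL-Analysis.Analysis" "HOL-Computational_Algebra.Computational_Algebra"
begin

definition hypergeom_term :: "complex list \<Rightarrow> complex list \<Rightarrow> nat \<Rightarrow> complex" where
  "hypergeom_term as bs k =
     (\<Prod>a\<leftarrow>as. pochhammer a k) / ((\<Prod>b\<leftarrow>bs. pochhammer b k) * fact k)"

text \<open>
  The generalized hypergeometric series at unit argument, with upper parameters \<open>as\<close> and
  lower parameters \<open>bs\<close>. If \<open>-n\<close> occurs in \<open>as\<close>, all terms of index above \<open>n\<close> are zero,
  also where \<open>bs\<close> contains a non-positive integer, since \<open>0 / 0 = 0\<close>.
\<close>
definition hypergeom :: "complex list \<Rightarrow> complex list \<Rightarrow> complex" where
  "hypergeom as bs = (\<Sum>k. hypergeom_term as bs k)"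

definition Saalschuetzian :: "complex list \<Rightarrow> complex list \<Rightarrow> bool" where
  "Saalschuetzian as bs \<longleftrightarrow> sum_list bs - sum_list as = 1"

definition add_params :: "complex list \<Rightarrow> nat list \<Rightarrow> complex list" where
  "add_params fs ms = map2 (\<lambda>f m. f + of_nat m) fs ms"

definition Qhat_fun ::
    "complex \<Rightarrow> complex \<Rightarrow> complex \<Rightarrow> complex list \<Rightarrow> nat list \<Rightarrow> complex \<Rightarrow> complex" where
  "Qhat_fun a b c fs ms t =
     (let m = sum_list ms; M = of_nat m in
      \<Sum>k=0..m.
        hypergeom (- of_nat k # add_params fs ms) fs
        * pochhammer a k * pochhammer b k * pochhammer t k
        / (pochhammer (c - a - M) k * pochhammer (c - b - M) k * fact k)
        * hypergeom [- M + of_nat k, t + of_nat k, c - a - b - M]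
                    [c - a - M + of_nat k, c - b - M + of_nat k])"

text \<open>
  \<open>Qhat_fun\<close> as an element of the library's polynomial type, for which degree and zeros with
  multiplicity are available. It is well defined by lemma \<open>poly_Qhat\<close> below.
\<close>
definition Qhat :: "complex \<Rightarrow> complex \<Rightarrow> complex \<Rightarrow> complex list \<Rightarrow> nat list \<Rightarrow> complex poly" where
  "Qhat a b c fs ms = (THE p. \<forall>t. poly p t = Qhat_fun a b c fs ms t)"

lemma hypergeom_eq_eval_fps: "hypergeom as bs = eval_fps (fps_hypergeo as bs 1) 1"
proof -
  have *: "foldl (\<lambda>r x. r * pochhammer x k) z xs = z * (\<Prod>x\<leftarrow>xs. pochhammer x k)"
    for k z and xs :: "complex list"
    by (induction xs arbitrary: z) (simp_all add: mult.assoc)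
  show ?thesis
    by (simp add: hypergeom_def hypergeom_term_def eval_fps_def fps_hypergeo_def *)
qed

lemma hypergeom_terminating:
  assumes "- of_nat n \<in> set as"
  shows "hypergeom as bs = (\<Sum>k\<le>n. hypergeom_term as bs k)"
  unfolding hypergeom_def
proof (rule suminf_finite)
  show "hypergeom_term as bs k = 0" if "k \<notin> {..n}" for k
  proof -
    have "pochhammer (- of_nat n :: complex) k = 0"
      using that by (simp add: pochhammer_of_nat_eq_0_lemma)
    hence "(\<Prod>a\<leftarrow>as. pochhammer a k) = 0"
      using assms by (force simp: prod_list_zero_iff)
    thus ?thesis by (simp add: hypergeom_term_def)
  qed
qed simp

lemma ex_poly_Qhat_fun: "\<exists>p. \<forall>t. poly p t = Qhat_fun a b c fs ms t"
proof -
  define m where "m = sum_list ms"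
  define A where "A k = hypergeom (- of_nat k # add_params fs ms) fs
    * pochhammer a k * pochhammer b k
    / (pochhammer (c - a - of_nat m) k * pochhammer (c - b - of_nat m) k * fact k)" for k
  define B where "B k j =
    pochhammer (- of_nat m + of_nat k) j * pochhammer (c - a - b - of_nat m) j
    / (pochhammer (c - a - of_nat m + of_nat k) j * pochhammer (c - b - of_nat m + of_nat k) j
       * fact j)" for k j
  define p where "p = (\<Sum>k=0..m. smult (A k) (pochhammer [:0, 1:] k *
    (\<Sum>j\<le>m - k. smult (B k j) (pochhammer [:of_nat k, 1:] j))))"
  have poch: "poly (pochhammer [:x, 1:] k) t = pochhammer (t + x) k" for x t :: complex and k
    by (induction k) (simp_all add: pochhammer_Suc algebra_simps)
  have "poly p t = Qhat_fun a b c fs ms t" for t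
  proof -
    have inner: "hypergeom [- of_nat m + of_nat k, t + of_nat k, c - a - b - of_nat m]
        [c - a - of_nat m + of_nat k, c - b - of_nat m + of_nat k]
      = (\<Sum>j\<le>m - k. B k j * pochhammer (t + of_nat k) j)" if "k \<le> m" for k
      by (subst hypergeom_terminating[of "m - k"])
         (use that in \<open>auto simp: of_nat_diff hypergeom_term_def B_def intro!: sum.cong\<close>)
    show ?thesis
      unfolding p_def Qhat_fun_def Let_def m_def[symmetric] poly_sum
      by (intro sum.cong refl)
         (simp add: inner poly_sum poch A_def del: minus_add_distrib add_uminus_conv_diff uminus_add_conv_diff)
  qed
  thus ?thesis by blast
qed

lemma poly_Qhat: "poly (Qhat a b c fs ms) t = Qhat_fun a b c fs ms t"
proof -
  obtain p where p: "\<forall>t. poly p t = Qhat_fun a b c fs ms t"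
    using ex_poly_Qhat_fun by blast
  have "\<forall>t. poly (Qhat a b c fs ms) t = Qhat_fun a b c fs ms t"
    unfolding Qhat_def
  proof (rule theI[of _ p])
    show "q = p" if "\<forall>t. poly q t = Qhat_fun a b c fs ms t" for q
      using that p by (metis poly_eqI2 poly_eq_poly_eq_iff ext)
  qed (rule p)
  thus ?thesis by blast
qed

end

theory Submission
  imports Defs
begin

text \<open>
  With \<open>\<lambda> = c - a - b - m\<close>, the hypothesis on \<open>\<zeta>\<close> makes the theorem a consequence of the
  power series identity \<open>F(a, b, f + m; c, f | x) = (1 - x)\<^sup>\<lambda> F(a + \<lambda>, b + \<lambda>, \<zeta> + 1; c, \<zeta> | x)\<close>:
  comparing coefficients, inserting this into the left-hand side and exchanging the two sums leaves
  inner sums that are Saalschuetzian \<open>3F2\<close> and are evaluated by the Pfaff-Saalschuetz theorem.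

  For the power series identity, \<open>(f + m)\<^sub>k / (f)\<^sub>k\<close> is a polynomial in \<open>k\<close> of degree at most \<open>m\<close>;
  its Newton expansion writes the left-hand side as a combination of the series
  \<open>x\<^sup>l F(a + l, b + l; c + l | x)\<close> with \<open>l \<le> m\<close>. Euler's transformation extracts
  \<open>(1 - x)\<^sup>\<lambda>\<close> and leaves \<open>x\<^sup>l (1 - x)\<^bsup>m - l\<^esup> F(c - a, c - b; c + l | x)\<close>, whose coefficients are
  the \<open>3F2\<close> in the definition of \<open>Q\<close> at \<open>t = - j\<close>. Finally \<open>Q(-j) = Q(-j) / Q(0) = (\<zeta> + 1)\<^sub>j / (\<zeta>)\<^sub>j\<close>.
\<close>

section \<open>The Pfaff-Saalschuetz summation\<close>

lemma pochhammer_split: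
  fixes x :: "'a::comm_semiring_1"
  assumes "i \<le> n"
  shows "pochhammer x n = pochhammer x i * pochhammer (x + of_nat i) (n - i)"
  using pochhammer_product[OF assms, of x] by simp

text \<open>The Pfaff-Saalschuetz sum multiplied through by its denominators, hence valid in every
  commutative ring. The induction passes from \<open>N\<close> to \<open>Suc N\<close> through the
  factor \<open>K\<close> between the two right-hand sides; summand by summand the difference
  telescopes.\<close>

lemma saalschuetz_denominator_free:
  fixes A B C :: "'a::comm_ring_1"
  shows "(\<Sum>i\<le>N. of_nat (N choose i) * pochhammer A i * pochhammer B i
            * pochhammer (C - A - B) (N - i) * pochhammer (C + of_nat i) (N - i))
       = pochhammer (C - A) N * pochhammer (C - B) N"
proof (induction N)
  case 0
  show ?case by simp
next
  case (Suc N)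
  define s where "s = C - A - B"
  define T where "T N i = of_nat (N choose i) * pochhammer A i * pochhammer B i
    * pochhammer s (N - i) * pochhammer (C + of_nat i) (N - i)" for N i
  define G where "G i = (case i of 0 \<Rightarrow> 0 | Suc j \<Rightarrow> of_nat (N choose j) * pochhammer A i
    * pochhammer B i * pochhammer s (N - j) * pochhammer (C + of_nat j) (N - j))" for i
  define K where "K = (C - A + of_nat N) * (C - B + of_nat N)"
  \<comment> \<open>\<open>- G\<close> is the companion of \<open>T\<close> in the sense of Wilf and Zeilberger.\<close>
  have step: "T (Suc N) i - K * T N i = G i - G (Suc i)" if "i \<le> N" for i
  proof -
    define P where "P = pochhammer A i * pochhammer B i * pochhammer s (N - i)
      * pochhammer (C + of_nat i) (N - i)"
    define x where "x = (of_nat i :: 'a)"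
    obtain l where l: "N = i + l" using le_Suc_ex[OF \<open>i \<le> N\<close>] by auto
    have T1: "T (Suc N) i = of_nat (Suc N choose i) * P * (s + of_nat N - x) * (C + of_nat N)"
      by (simp add: T_def P_def x_def l Suc_diff_le pochhammer_Suc algebra_simps)
    have T2: "T N i = of_nat (N choose i) * P"
      by (simp add: T_def P_def algebra_simps)
    have G1: "G (Suc i) = of_nat (N choose i) * P * (A + x) * (B + x)"
      by (simp add: G_def P_def x_def pochhammer_Suc algebra_simps)
    show ?thesis
    proof (cases i)
      case 0
      then show ?thesis
        unfolding T1 T2 G1 by (simp add: G_def K_def s_def x_def algebra_simps)
    next
      case (Suc j)
      define c0 c1 where "c0 = (of_nat (N choose i) :: 'a)" and "c1 = (of_nat (N choose j) :: 'a)"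
      have Nj: "N - j = Suc (N - i)" using that Suc by simp
      have G0: "G i = c1 * P * (s + of_nat N - x) * (C + x - 1)"
      proof -
        have e1: "pochhammer (C + of_nat j) (Suc (N - i)) = (C + x - 1) * pochhammer (C + of_nat i) (N - i)"
          by (simp add: pochhammer_rec Suc x_def algebra_simps)
        have e2: "pochhammer s (Suc (N - i)) = pochhammer s (N - i) * (s + of_nat N - x)"
          using that by (simp add: pochhammer_Suc x_def of_nat_diff algebra_simps)
        have "G i = c1 * pochhammer A i * pochhammer B i * pochhammer s (Suc (N - i))
            * pochhammer (C + of_nat j) (Suc (N - i))"
          using Nj by (simp add: G_def Suc c1_def)
        thus ?thesis
          unfolding e1 e2 P_def by (simp only: mult_ac)
      qed
      have "i * (N choose i) = (N - j) * (N choose j)"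
        unfolding Suc by (simp only: binomial_absorption binomial_absorb_comp)
      hence "of_nat (i * (N choose i)) = (of_nat ((N - j) * (N choose j)) :: 'a)" by simp
      hence R: "x * c0 = (of_nat N + 1 - x) * c1"
        using that Suc by (simp add: x_def c0_def c1_def of_nat_diff algebra_simps)
      have Ch: "of_nat (Suc N choose i) = c0 + c1"
        by (simp add: Suc c0_def c1_def)
      \<comment> \<open>After Pascal's rule \<open>Ch\<close>, all that is left is a multiple of the
        absorption identity \<open>R\<close>.\<close>
      have "T (Suc N) i - K * T N i - (G i - G (Suc i))
          = P * (s + of_nat N - x) * ((of_nat N + 1 - x) * c1 - x * c0)"
        unfolding T1 T2 G1 G0 Ch K_def c0_def[symmetric] s_def by (simp add: algebra_simps)
      thus ?thesis by (simp add: R)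
    qed
  qed
  have "(\<Sum>i\<le>N. T (Suc N) i) - K * (\<Sum>i\<le>N. T N i) = (\<Sum>i\<le>N. G i - G (Suc i))"
    unfolding sum_distrib_left sum_subtractf[symmetric] by (intro sum.cong refl step) simp
  also have "\<dots> = G 0 - G (Suc N)"
    by (rule sum_telescope)
  \<comment> \<open>\<open>G 0 = 0\<close>, and \<open>G (Suc N)\<close> is exactly the top summand
    missing from the range \<open>i \<le> N\<close>.\<close>
  also have "\<dots> = - T (Suc N) (Suc N)"
    by (simp add: G_def T_def)
  finally have "(\<Sum>i\<le>Suc N. T (Suc N) i) = K * (\<Sum>i\<le>N. T N i)"
    by (simp add: algebra_simps)
  also have "(\<Sum>i\<le>N. T N i) = pochhammer (C - A) N * pochhammer (C - B) N"
    unfolding T_def s_def by (rule Suc.IH)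
  also have "K * \<dots> = pochhammer (C - A) (Suc N) * pochhammer (C - B) (Suc N)"
    by (simp add: K_def pochhammer_Suc algebra_simps)
  finally show ?case
    by (simp only: T_def s_def)
qed

text \<open>The balance condition makes \<open>C - A - B\<close> equal to \<open>1 - D - N\<close>;
  reflecting its Pochhammer symbols gives the form symmetric in \<open>C\<close> and
  \<open>D\<close>, up to signs that cancel.\<close>

lemma saalschuetz:
  fixes A B C D :: "'a::comm_ring_1"
  assumes "C + D + of_nat N = A + B + 1"
  shows "(\<Sum>i\<le>N. (-1) ^ i * of_nat (N choose i) * pochhammer A i * pochhammer B i
            * pochhammer (C + of_nat i) (N - i) * pochhammer (D + of_nat i) (N - i))
       = pochhammer (C - B) N * pochhammer (D - B) N"
proof -
  have sq: "(-1) ^ k * ((-1) ^ k * x) = x" for k and x :: 'a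
    by (simp add: mult.assoc[symmetric] flip: power_mult_distrib)
  have D: "C - A - B = - (D + of_nat N - 1)" "C - A = - (D - B + of_nat N - 1)"
    using assms by (simp_all add: algebra_simps)
  have "(\<Sum>i\<le>N. (-1) ^ i * of_nat (N choose i) * pochhammer A i * pochhammer B i
            * pochhammer (C + of_nat i) (N - i) * pochhammer (D + of_nat i) (N - i))
    = (\<Sum>i\<le>N. (-1) ^ N * (of_nat (N choose i) * pochhammer A i * pochhammer B i
            * pochhammer (C - A - B) (N - i) * pochhammer (C + of_nat i) (N - i)))"
  proof (intro sum.cong refl)
    fix i assume "i \<in> {..N}"
    then obtain l where l: "N = i + l" by (metis atMost_iff le_Suc_ex)
    have "pochhammer (C - A - B) l = (-1) ^ l * pochhammer (D + of_nat i) l"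
      unfolding D(1) pochhammer_minus l by (simp add: algebra_simps)
    thus "(-1) ^ i * of_nat (N choose i) * pochhammer A i * pochhammer B i
            * pochhammer (C + of_nat i) (N - i) * pochhammer (D + of_nat i) (N - i)
      = (-1) ^ N * (of_nat (N choose i) * pochhammer A i * pochhammer B i
            * pochhammer (C - A - B) (N - i) * pochhammer (C + of_nat i) (N - i))"
      by (simp add: l power_add mult_ac sq)
  qed
  also have "\<dots> = (-1) ^ N * (pochhammer (C - A) N * pochhammer (C - B) N)"
    by (simp only: sum_distrib_left[symmetric] saalschuetz_denominator_free)
  also have "pochhammer (C - A) N = (-1) ^ N * pochhammer (D - B) N"
    unfolding D(2) pochhammer_minus by (simp add: algebra_simps)
  finally show ?thesis by (simp add: mult_ac sq)
qed

section \<open>Binomial and Gauss series, Euler's transformation\<close>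

text \<open>The series \<open>(1 - x)\<^bsup>-u\<^esup>\<close>.\<close>
definition neg_binomial_fps :: "'a::field_char_0 \<Rightarrow> 'a fps" where
  "neg_binomial_fps u = Abs_fps (\<lambda>k. pochhammer u k / fact k)"

text \<open>A formal power series is used so that products are Cauchy products and convergence does
  not enter.\<close>

definition gauss_fps :: "'a::field_char_0 \<Rightarrow> 'a \<Rightarrow> 'a \<Rightarrow> 'a fps" where
  "gauss_fps a b c = Abs_fps (\<lambda>k. pochhammer a k * pochhammer b k / (pochhammer c k * fact k))"

text \<open>On coefficients, one factor \<open>1 - fps_X\<close> amounts to
  \<open>(v)_(j+1) - (j+1) (v)_j = (v-1)_(j+1)\<close>.\<close>

lemma neg_binomial_fps_mult:
  "neg_binomial_fps u * (1 - fps_X) ^ p = neg_binomial_fps (u - of_nat p)"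
proof (induction p)
  case (Suc p)
  have "neg_binomial_fps v * (1 - fps_X) = neg_binomial_fps (v - 1)" for v :: 'a
  proof (rule fps_ext)
    fix k
    show "fps_nth (neg_binomial_fps v * (1 - fps_X)) k = fps_nth (neg_binomial_fps (v - 1)) k"
    proof (cases k)
      case (Suc j)
      have "fps_nth (neg_binomial_fps v * (1 - fps_X)) k
          = pochhammer v (Suc j) / fact (Suc j) - pochhammer v j / fact j"
        by (simp add: neg_binomial_fps_def right_diff_distrib Suc del: fact_Suc)
      also have "\<dots> = (pochhammer v (Suc j) - of_nat (Suc j) * pochhammer v j) / fact (Suc j)"
        by (simp add: diff_divide_distrib del: of_nat_Suc)
      also have "pochhammer v (Suc j) - of_nat (Suc j) * pochhammer v j = pochhammer (v - 1) (Suc j)"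
        by (simp add: pochhammer_Suc[of v] pochhammer_rec[of "v - 1"] algebra_simps)
      finally show ?thesis
        by (simp add: neg_binomial_fps_def Suc)
    qed (simp add: neg_binomial_fps_def right_diff_distrib)
  qed
  note this[of "u - of_nat p"]
  then show ?case
    by (simp add: Suc.IH mult.assoc[symmetric] power_Suc2 diff_diff_eq add.commute del: power_Suc)
qed (simp add: neg_binomial_fps_def)

lemma pochhammer_nonzero:
  fixes c :: "'a::field_char_0"
  assumes "c \<notin> \<int>\<^sub>\<le>\<^sub>0"
  shows "pochhammer c k \<noteq> 0"
  using assms by (auto simp: pochhammer_eq_0_iff)

text \<open>After multiplication by \<open>(c)_k k!\<close>, the \<open>k\<close>-th coefficient of
  the product is the sum in \<open>saalschuetz_denominator_free\<close> with
  \<open>A = c - a\<close>, \<open>B = c - b\<close>, \<open>C = c\<close>, whose value is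
  \<open>(a)_k (b)_k\<close>.\<close>

lemma gauss_fps_euler:
  assumes c: "c \<notin> \<int>\<^sub>\<le>\<^sub>0"
  shows "gauss_fps a b c = neg_binomial_fps (a + b - c) * gauss_fps (c - a) (c - b) c"
proof (rule fps_ext)
  fix k
  note nz = pochhammer_nonzero[OF c]
  have "fps_nth (neg_binomial_fps (a + b - c) * gauss_fps (c - a) (c - b) c) k
      = (\<Sum>i\<le>k. pochhammer (c - a) i * pochhammer (c - b) i / (pochhammer c i * fact i)
          * (pochhammer (a + b - c) (k - i) / fact (k - i)))"
    by (subst mult.commute)
       (simp add: fps_mult_nth neg_binomial_fps_def gauss_fps_def atLeast0AtMost)
  also have "\<dots> = (\<Sum>i\<le>k. of_nat (k choose i) * pochhammer (c - a) i * pochhammer (c - b) i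
          * pochhammer (c - (c - a) - (c - b)) (k - i) * pochhammer (c + of_nat i) (k - i))
        / (pochhammer c k * fact k)"
    unfolding sum_divide_distrib
  proof (intro sum.cong refl)
    fix i assume "i \<in> {..k}"
    hence i: "i \<le> k" by simp
    have "pochhammer (c + of_nat i) (k - i) \<noteq> 0"
      using pochhammer_split[OF i, of c] nz[of k] by auto
    moreover have "c - (c - a) - (c - b) = a + b - c" by simp
    ultimately show "pochhammer (c - a) i * pochhammer (c - b) i / (pochhammer c i * fact i)
          * (pochhammer (a + b - c) (k - i) / fact (k - i))
      = of_nat (k choose i) * pochhammer (c - a) i * pochhammer (c - b) i
          * pochhammer (c - (c - a) - (c - b)) (k - i) * pochhammer (c + of_nat i) (k - i)
        / (pochhammer c k * fact k)"
      using nz[of i]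
      by (simp only: binomial_fact[OF i] pochhammer_split[OF i, of c]) (simp add: divide_simps)
  qed
  also have "\<dots> = fps_nth (gauss_fps a b c) k"
    unfolding saalschuetz_denominator_free by (simp add: gauss_fps_def)
  finally show "fps_nth (gauss_fps a b c) k
      = fps_nth (neg_binomial_fps (a + b - c) * gauss_fps (c - a) (c - b) c) k" ..
qed

section \<open>Gauss series multiplied by powers of \<open>1 - x\<close>\<close>

text \<open>This is \<open>x\<^sup>s F(a + s, b + s; c + s | x) / (c)\<^sub>s\<close>.\<close>
definition gauss_shift :: "nat \<Rightarrow> 'a::field_char_0 \<Rightarrow> 'a \<Rightarrow> 'a \<Rightarrow> 'a fps" where
  "gauss_shift s a b c = Abs_fps (\<lambda>i. if i < s then 0 else
     pochhammer (a + of_nat s) (i - s) * pochhammer (b + of_nat s) (i - s)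
     / (pochhammer c i * fact (i - s)))"

text \<open>A contiguous relation that trades one factor \<open>1 - x\<close> for unit shifts in
  \<open>a\<close>, \<open>b\<close> and \<open>s\<close>; it drives the induction in
  \<open>gauss_fps_times_power\<close>.\<close>

lemma gauss_shift_step:
  assumes c: "c \<notin> \<int>\<^sub>\<le>\<^sub>0"
  shows "(1 - fps_X) * gauss_shift s (a + 1) (b + 1) c
    = gauss_shift s a b c + fps_const (a + b - c + 1 + of_nat s) * gauss_shift (Suc s) a b c"
proof (rule fps_ext)
  fix i
  consider "i < s" | "i = s" | l where "i = Suc (s + l)"
    by (metis less_imp_Suc_add linorder_neqE_nat)
  thus "fps_nth ((1 - fps_X) * gauss_shift s (a + 1) (b + 1) c) i
    = fps_nth (gauss_shift s a b c
        + fps_const (a + b - c + 1 + of_nat s) * gauss_shift (Suc s) a b c) i"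
  proof cases
    case 3
    define P Q where "P = pochhammer (a + 1 + of_nat s) l" and "Q = pochhammer (b + 1 + of_nat s) l"
    define R where "R = pochhammer c (s + l)"
    define x y where "x = (of_nat s :: 'a)" and "y = (of_nat l :: 'a)"
    have R: "R \<noteq> 0" "c + x + y \<noteq> 0"
      using pochhammer_nonzero[OF c, of "s + l"] pochhammer_nonzero[OF c, of "Suc (s + l)"]
      by (auto simp: R_def x_def y_def pochhammer_Suc add_ac)
    have y: "1 + y \<noteq> 0" unfolding y_def by (metis of_nat_Suc of_nat_neq_0)
    have lhs: "fps_nth ((1 - fps_X) * gauss_shift s (a + 1) (b + 1) c) i
      = P * (a + 1 + x + y) * (Q * (b + 1 + x + y)) / (R * (c + x + y) * ((1 + y) * fact l))
        - P * Q / (R * fact l)"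
      by (simp add: 3 left_diff_distrib gauss_shift_def P_def Q_def R_def x_def y_def Suc_diff_le
          pochhammer_Suc add_ac)
    have rhs: "fps_nth (gauss_shift s a b c
        + fps_const (a + b - c + 1 + of_nat s) * gauss_shift (Suc s) a b c) i
      = (a + x) * P * ((b + x) * Q) / (R * (c + x + y) * ((1 + y) * fact l))
        + (a + b - c + 1 + x) * (P * Q / (R * (c + x + y) * fact l))"
      by (simp add: 3 gauss_shift_def P_def Q_def R_def x_def y_def Suc_diff_le
          pochhammer_rec[of "a + of_nat s"] pochhammer_rec[of "b + of_nat s"]
          pochhammer_Suc[of c] add_ac)
    \<comment> \<open>Clearing the common factors leaves \<open>(A + w) (B + w) - (c + x + y) w = A
      B + (a + b - c + 1 + x) w\<close> with \<open>A = a + x\<close>, \<open>B = b + x\<close>,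
      \<open>w = 1 + y\<close>.\<close>
    show ?thesis
      unfolding lhs rhs using R y by (simp add: divide_simps) (simp add: algebra_simps)
  qed (simp_all add: left_diff_distrib gauss_shift_def)
qed

text \<open>Expanding in the unshifted parameters \<open>a\<close>, \<open>b\<close> makes each
  coefficient a terminating \<open>3F2\<close>.\<close>

lemma gauss_fps_times_power:
  assumes c: "c \<notin> \<int>\<^sub>\<le>\<^sub>0"
  shows "(1 - fps_X) ^ p * gauss_fps (a + of_nat p) (b + of_nat p) c
    = (\<Sum>s\<le>p. fps_const (of_nat (p choose s) * pochhammer (a + b - c + of_nat p) s)
        * gauss_shift s a b c)"
proof (induction p arbitrary: a b)
  case 0
  show ?case by (simp add: gauss_fps_def gauss_shift_def)
next
  case (Suc p)
  define L where "L = a + b - c + of_nat (Suc p)"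
  \<comment> \<open>The induction hypothesis at \<open>a + 1\<close>, \<open>b + 1\<close> carries
    the parameter \<open>L + 1\<close> in place of \<open>L\<close>.\<close>
  define u where "u s = of_nat (p choose s) * pochhammer (L + 1) s" for s
  define g where "g s = gauss_shift s a b c" for s
  \<comment> \<open>Since \<open>a + b - c + 1 + s = L - p + s\<close>, this Pascal-type recursion
    reduces to the absorption identity \<open>e\<close>.\<close>
  have coeff: "u (Suc s) + u s * (a + b - c + 1 + of_nat s)
      = of_nat (Suc p choose Suc s) * pochhammer L (Suc s)" if "s \<le> p" for s
  proof -
    have "Suc s * (p choose Suc s) = (p - s) * (p choose s)"
      by (simp only: binomial_absorption binomial_absorb_comp)
    hence "of_nat (Suc s * (p choose Suc s)) = (of_nat ((p - s) * (p choose s)) :: 'a)"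
      by simp
    hence e: "(1 + of_nat s) * of_nat (p choose Suc s)
        = (of_nat p - of_nat s) * (of_nat (p choose s) :: 'a)"
      using that by (simp only: of_nat_mult of_nat_Suc of_nat_diff)
    have "u (Suc s) + u s * (a + b - c + 1 + of_nat s)
        - of_nat (Suc p choose Suc s) * pochhammer L (Suc s)
      = pochhammer (L + 1) s * ((1 + of_nat s) * of_nat (p choose Suc s)
        - (of_nat p - of_nat s) * of_nat (p choose s))"
      unfolding u_def pochhammer_Suc[of "L + 1"] pochhammer_rec[of L]
      by (simp add: L_def algebra_simps)
    thus ?thesis by (simp add: e)
  qed
  have "(1 - fps_X) ^ Suc p * gauss_fps (a + of_nat (Suc p)) (b + of_nat (Suc p)) c
    = (1 - fps_X) * ((1 - fps_X) ^ p * gauss_fps ((a + 1) + of_nat p) ((b + 1) + of_nat p) c)"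
    by (simp add: mult.assoc add_ac)
  also have "\<dots> = (\<Sum>s\<le>p. fps_const (u s) * ((1 - fps_X) * gauss_shift s (a + 1) (b + 1) c))"
    unfolding Suc.IH sum_distrib_left by (simp add: u_def L_def algebra_simps)
  also have "\<dots> = (\<Sum>s\<le>p. fps_const (u s) * g s)
      + (\<Sum>s\<le>p. fps_const (u s * (a + b - c + 1 + of_nat s)) * g (Suc s))"
  proof -
    have "fps_const v * (x + fps_const w * y) = fps_const v * x + fps_const (v * w) * y"
      for v w :: 'a and x y
      by (simp add: distrib_left mult.assoc flip: fps_const_mult)
    thus ?thesis
      by (simp only: gauss_shift_step[OF c] sum.distrib g_def)
  qed
  \<comment> \<open>The added term has the factor \<open>p choose Suc p = 0\<close>; the longer
    range permits splitting off \<open>g 0\<close> and shifting the index.\<close>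
  also have "(\<Sum>s\<le>p. fps_const (u s) * g s) = (\<Sum>s\<le>Suc p. fps_const (u s) * g s)"
    by (simp add: u_def)
  also have "\<dots> = g 0 + (\<Sum>s\<le>p. fps_const (u (Suc s)) * g (Suc s))"
    by (simp add: sum.atMost_Suc_shift u_def del: sum.atMost_Suc)
  also have "g 0 + (\<Sum>s\<le>p. fps_const (u (Suc s)) * g (Suc s))
      + (\<Sum>s\<le>p. fps_const (u s * (a + b - c + 1 + of_nat s)) * g (Suc s))
    = g 0 + (\<Sum>s\<le>p. fps_const (of_nat (Suc p choose Suc s) * pochhammer L (Suc s)) * g (Suc s))"
    by (simp only: add.assoc[of "g 0"] sum.distrib[symmetric] distrib_right[symmetric] fps_const_add)
       (intro arg_cong2[where f = "(+)"] sum.cong refl; simp only: coeff atMost_iff)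
  also have "\<dots> = (\<Sum>s\<le>Suc p. fps_const (of_nat (Suc p choose s) * pochhammer L s) * g s)"
    by (simp add: sum.atMost_Suc_shift del: sum.atMost_Suc binomial_Suc_Suc)
  finally show ?case
    unfolding L_def g_def .
qed

lemma pochhammer_neg_of_nat:
  "pochhammer (- of_nat l :: 'a::field_char_0) i / fact i = (- 1) ^ i * of_nat (l choose i)"
  by (simp add: binomial_gbinomial gbinomial_pochhammer flip: power_mult_distrib)

text \<open>Here \<open>p choose s\<close> is \<open>(-1)^s (-p)_s / s!\<close> and
  \<open>1 / (i - s)!\<close> is \<open>(-1)^s (-i)_s / i!\<close>, so the expansion turns into the
  \<open>3F2\<close>. The hypotheses on \<open>a\<close> and \<open>b\<close> keep its lower
  Pochhammer symbols nonzero for \<open>s \<le> p\<close>.\<close>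

lemma gauss_fps_times_power_nth:
  assumes c: "c \<notin> \<int>\<^sub>\<le>\<^sub>0" and a: "pochhammer a p \<noteq> 0" and b: "pochhammer b p \<noteq> 0"
  shows "fps_nth ((1 - fps_X) ^ p * gauss_fps (a + of_nat p) (b + of_nat p) c) i
    = pochhammer a i * pochhammer b i / (pochhammer c i * fact i)
      * hypergeom [- of_nat p, - of_nat i, a + b - c + of_nat p] [a, b]"
proof -
  define L where "L = a + b - c + of_nat p"
  have "of_nat (p choose s) * pochhammer L s * fps_nth (gauss_shift s a b c) i
    = pochhammer a i * pochhammer b i / (pochhammer c i * fact i)
      * hypergeom_term [- of_nat p, - of_nat i, L] [a, b] s" if "s \<le> p" for s
  proof (cases "i < s")
    case True
    hence "pochhammer (- of_nat i :: complex) s = 0"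
      by (simp add: pochhammer_of_nat_eq_0_lemma)
    with True show ?thesis by (simp add: gauss_shift_def hypergeom_term_def)
  next
    case False
    hence si: "s \<le> i" by simp
    have nz: "pochhammer a s \<noteq> 0" "pochhammer b s \<noteq> 0"
      using a b pochhammer_split[OF that, of a] pochhammer_split[OF that, of b] by auto
    have "hypergeom_term [- of_nat p, - of_nat i, L] [a, b] s
      = (pochhammer (- of_nat p) s / fact s) * (pochhammer (- of_nat i) s / fact s) * fact s
        * pochhammer L s / (pochhammer a s * pochhammer b s)"
      by (simp add: hypergeom_term_def mult_ac)
    also have "\<dots> = of_nat (p choose s) * of_nat (i choose s) * fact s * pochhammer L s
        / (pochhammer a s * pochhammer b s)"
      unfolding pochhammer_neg_of_nat by (simp add: mult_ac flip: power_mult_distrib)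
    finally show ?thesis
      using nz False
      by (simp add: gauss_shift_def binomial_fact[OF si] pochhammer_split[OF si, of a]
          pochhammer_split[OF si, of b])
  qed
  hence "(\<Sum>s\<le>p. of_nat (p choose s) * pochhammer L s * fps_nth (gauss_shift s a b c) i)
    = (\<Sum>s\<le>p. pochhammer a i * pochhammer b i / (pochhammer c i * fact i)
        * hypergeom_term [- of_nat p, - of_nat i, L] [a, b] s)"
    by (intro sum.cong) simp_all
  thus ?thesis
    unfolding gauss_fps_times_power[OF c]
    by (subst hypergeom_terminating[of p]) (simp_all add: fps_sum_nth sum_distrib_left L_def)
qed

section \<open>Finite differences and the Newton expansion of the parameter ratio\<close>

text \<open>Pascal's rule: a difference of order \<open>Suc n\<close> is a difference of order
  \<open>n\<close> of the first differences.\<close>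

lemma alternating_binomial_sum_Suc:
  fixes f :: "nat \<Rightarrow> 'a::comm_ring_1"
  shows "(\<Sum>i\<le>Suc n. (-1) ^ i * of_nat (Suc n choose i) * f i)
    = (\<Sum>i\<le>n. (-1) ^ i * of_nat (n choose i) * (f i - f (Suc i)))"
proof -
  have "(\<Sum>i\<le>n. (-1) ^ i * of_nat (n choose i) * f i)
      = (\<Sum>i\<le>Suc n. (-1) ^ i * of_nat (n choose i) * f i)"
    by (simp add: binomial_eq_0)
  also have "\<dots> = f 0 - (\<Sum>i\<le>n. (-1) ^ i * of_nat (n choose Suc i) * f (Suc i))"
    by (simp add: sum.atMost_Suc_shift sum_negf del: sum.atMost_Suc)
  finally show ?thesis
    by (simp add: sum.atMost_Suc_shift sum_negf sum_subtractf sum.distrib algebra_simps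
        del: sum.atMost_Suc)
qed

text \<open>Passing from \<open>p(x)\<close> to \<open>p(x) - p(x + 1)\<close> lowers both the order
  and the degree, as the leading terms cancel. The alternative \<open>p = 0\<close> covers order 0,
  where no degree is small enough.\<close>

lemma alternating_binomial_sum_poly_eq_0:
  fixes p :: "'a::idom poly"
  assumes "degree p < n \<or> p = 0"
  shows "(\<Sum>i\<le>n. (-1) ^ i * of_nat (n choose i) * poly p (of_nat i)) = 0"
  using assms
proof (induction n arbitrary: p)
  case (Suc n)
  define q where "q = p - pcompose p [:1, 1:]"
  have q: "degree q < n \<or> q = 0"
  proof (cases "degree p = 0")
    case True
    then obtain k where "p = [:k:]" by (rule degree_eq_zeroE)
    thus ?thesis by (simp add: q_def)
  next
    case False
    have "degree q \<le> degree p" unfolding q_def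
      by (rule degree_diff_le) (simp_all add: degree_pcompose)
    moreover have "coeff q (degree p) = 0"
      using lead_coeff_comp[of "[:1, 1:]" p] by (simp add: q_def degree_pcompose)
    ultimately have "degree q < degree p \<or> q = 0"
      by (metis le_neq_implies_less leading_coeff_0_iff)
    thus ?thesis using Suc.prems False by auto
  qed
  have "(\<Sum>i\<le>n. (-1) ^ i * of_nat (n choose i) * poly q (of_nat i)) = 0"
    by (rule Suc.IH[OF q])
  moreover have "poly q (of_nat i) = poly p (of_nat i) - poly p (of_nat (Suc i))" for i
    by (simp add: q_def poly_pcompose)
  ultimately show ?case
    by (simp only: alternating_binomial_sum_Suc)
qed simp

text \<open>The involution property of the binomial transform: the hypothesis is applied to
  \<open>i \<mapsto> f (Suc i)\<close>, and \<open>alternating_binomial_sum_Suc\<close> reduces both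
  the outer and the inner sum.\<close>

lemma binomial_inversion:
  fixes f :: "nat \<Rightarrow> 'a::comm_ring_1"
  shows "f k = (\<Sum>l\<le>k. (-1) ^ l * of_nat (k choose l)
    * (\<Sum>i\<le>l. (-1) ^ i * of_nat (l choose i) * f i))"
proof (induction k arbitrary: f)
  case (Suc k)
  have "f (Suc k) = (\<Sum>l\<le>k. (-1) ^ l * of_nat (k choose l)
    * (\<Sum>i\<le>l. (-1) ^ i * of_nat (l choose i) * f (Suc i)))"
    by (rule Suc.IH)
  thus ?case
    by (simp add: alternating_binomial_sum_Suc right_diff_distrib sum_subtractf del: sum.atMost_Suc)
qed simp

text \<open>Differences of order above the degree vanish, so the inversion formula can be cut at
  \<open>m\<close>, a range independent of \<open>k\<close>.\<close>

lemma newton_expansion: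
  fixes p :: "'a::idom poly"
  assumes "degree p \<le> m"
  shows "poly p (of_nat k) = (\<Sum>l\<le>m. (-1) ^ l * of_nat (k choose l)
    * (\<Sum>i\<le>l. (-1) ^ i * of_nat (l choose i) * poly p (of_nat i)))"
proof -
  define t where "t l = (-1) ^ l * of_nat (k choose l)
    * (\<Sum>i\<le>l. (-1) ^ i * of_nat (l choose i) * poly p (of_nat i))" for l
  have z: "t l = 0" if "l > k \<or> l > m" for l
    using that assms alternating_binomial_sum_poly_eq_0[of p l] by (auto simp: t_def binomial_eq_0)
  have "poly p (of_nat k) = (\<Sum>l\<le>k. t l)"
    unfolding t_def by (rule binomial_inversion)
  \<comment> \<open>Both ranges are compared through \<open>k + m\<close>: the terms vanish above
    \<open>k\<close> by the binomial coefficient and above \<open>m\<close> by the degree.\<close>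
  also have "\<dots> = (\<Sum>l\<le>k + m. t l)"
    by (rule sum.mono_neutral_left) (auto simp: z)
  also have "\<dots> = (\<Sum>l\<le>m. t l)"
    by (rule sum.mono_neutral_right) (auto simp: z)
  finally show ?thesis unfolding t_def .
qed

text \<open>Both sides are \<open>(f)_(k+i) / ((f)_k (f)_i)\<close>. The exchange turns a quotient
  of symbols of length \<open>i\<close> into a polynomial in \<open>i\<close> of degree
  \<open>k\<close>.\<close>

lemma pochhammer_shift_ratio:
  fixes f :: "'a::field_char_0"
  assumes "f \<notin> \<int>\<^sub>\<le>\<^sub>0"
  shows "pochhammer (f + of_nat k) i / pochhammer f i = pochhammer (f + of_nat i) k / pochhammer f k"
  using pochhammer_product'[of f k i] pochhammer_product'[of f i k]
    pochhammer_nonzero[OF assms, of i] pochhammer_nonzero[OF assms, of k]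
  by (simp add: field_simps add.commute)

lemma poly_pochhammer: "poly (pochhammer p k) x = pochhammer (poly p x) k"
  for p :: "'a::comm_semiring_1 poly"
  by (induction k) (simp_all add: pochhammer_Suc)

lemma degree_pochhammer_le:
  fixes p :: "'a::comm_semiring_1 poly"
  assumes "degree p \<le> 1"
  shows "degree (pochhammer p k) \<le> k"
proof (induction k)
  case (Suc k)
  have "degree (p + of_nat k) \<le> 1"
    using assms by (intro degree_add_le) simp_all
  thus ?case
    using Suc degree_mult_le[of "pochhammer p k" "p + of_nat k"] by (simp add: pochhammer_Suc)
qed simp

text \<open>By \<open>pochhammer_shift_ratio\<close> each pair \<open>f\<close>, \<open>k\<close>
  contributes a polynomial in \<open>i\<close> of degree at most \<open>k\<close>; in the product
  the degrees add up.\<close>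

lemma ex_poly_add_params_ratio:
  assumes "length fs = length ms" "set fs \<inter> \<int>\<^sub>\<le>\<^sub>0 = {}"
  shows "\<exists>p. degree p \<le> sum_list ms \<and> (\<forall>i. poly p (of_nat i)
    = (\<Prod>x\<leftarrow>add_params fs ms. pochhammer x i) / (\<Prod>x\<leftarrow>fs. pochhammer x i))"
  using assms
proof (induction fs ms rule: list_induct2)
  case Nil
  show ?case by (rule exI[of _ 1]) (simp add: add_params_def)
next
  case (Cons f fs k ms)
  then obtain p where p: "degree p \<le> sum_list ms" "poly p (of_nat i)
    = (\<Prod>x\<leftarrow>add_params fs ms. pochhammer x i) / (\<Prod>x\<leftarrow>fs. pochhammer x i)" for i
    by auto
  define q where "q = smult (1 / pochhammer f k) (pochhammer [:f, 1:] k)"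
  have "degree q \<le> k"
    by (simp add: q_def degree_pochhammer_le)
  moreover have "poly q (of_nat i) = pochhammer (f + of_nat k) i / pochhammer f i" for i
    using Cons.prems by (subst pochhammer_shift_ratio) (auto simp: q_def poly_pochhammer)
  moreover have "degree (q * p) \<le> degree q + degree p"
    by (rule degree_mult_le)
  ultimately show ?case
    using p by (intro exI[of _ "q * p"] conjI allI) (simp_all add: add_params_def)
qed

text \<open>The differences in the Newton expansion are terminating series because
  \<open>(-l)_i / i! = (-1)^i (l choose i)\<close>; they are the first factors in the definition of
  \<open>Qhat_fun\<close>.\<close>

lemma hypergeom_add_params_newton:
  assumes "length fs = length ms" "set fs \<inter> \<int>\<^sub>\<le>\<^sub>0 = {}"
  shows "(\<Prod>x\<leftarrow>add_params fs ms. pochhammer x k) / (\<Prod>x\<leftarrow>fs. pochhammer x k)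
    = (\<Sum>l\<le>sum_list ms. (-1) ^ l * of_nat (k choose l)
        * hypergeom (- of_nat l # add_params fs ms) fs)"
proof -
  obtain p where p: "degree p \<le> sum_list ms" "\<And>i. poly p (of_nat i)
    = (\<Prod>x\<leftarrow>add_params fs ms. pochhammer x i) / (\<Prod>x\<leftarrow>fs. pochhammer x i)"
    using ex_poly_add_params_ratio[OF assms] by auto
  have "hypergeom (- of_nat l # add_params fs ms) fs
      = (\<Sum>i\<le>l. (-1) ^ i * of_nat (l choose i) * poly p (of_nat i))" for l
    unfolding p pochhammer_neg_of_nat[symmetric]
    by (subst hypergeom_terminating[of l]) (simp_all add: hypergeom_term_def mult_ac)
  thus ?thesis
    using newton_expansion[OF p(1), of k] by (simp add: p)
qed

section \<open>The power series transformation with \<open>Qhat_fun\<close>\<close>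

lemma add_of_nat_notin_nonpos_Ints:
  fixes c :: "'a::ring_char_0"
  assumes "c \<notin> \<int>\<^sub>\<le>\<^sub>0"
  shows "c + of_nat l \<notin> \<int>\<^sub>\<le>\<^sub>0"
proof
  assume "c + of_nat l \<in> \<int>\<^sub>\<le>\<^sub>0"
  then obtain n where "c + of_nat l = - of_nat n" by (elim nonpos_Ints_cases')
  hence "c = - of_nat n - of_nat l" by (metis add_diff_cancel_right')
  also have "\<dots> = - of_nat (n + l)" by simp
  finally have "c = - of_nat (n + l)" .
  thus False using assms by blast
qed

text \<open>Euler's transformation yields the exponent \<open>c - a - b - l\<close>; writing it as
  \<open>(c - a - b - m) + (m - l)\<close> isolates a power of \<open>1 - x\<close> common to all
  \<open>l\<close>.\<close>

lemma gauss_fps_shift_transform: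
  assumes c: "c \<notin> \<int>\<^sub>\<le>\<^sub>0" and l: "l \<le> m"
  shows "gauss_fps (a + of_nat l) (b + of_nat l) (c + of_nat l)
    = neg_binomial_fps (a + b - c + of_nat m)
      * ((1 - fps_X) ^ (m - l) * gauss_fps (c - a) (c - b) (c + of_nat l))"
proof -
  have "a + of_nat l + (b + of_nat l) - (c + of_nat l) = a + b - c + of_nat m - of_nat (m - l)"
    using l by (simp add: of_nat_diff)
  moreover have "c + of_nat l - (a + of_nat l) = c - a" "c + of_nat l - (b + of_nat l) = c - b"
    by simp_all
  ultimately show ?thesis
    using gauss_fps_euler[OF add_of_nat_notin_nonpos_Ints[OF c, of l],
        of "a + of_nat l" "b + of_nat l"]
    by (simp only: neg_binomial_fps_mult[symmetric] mult.assoc)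
qed

text \<open>Produces the inner \<open>3F2\<close> of \<open>Qhat_fun\<close> at
  \<open>t = -j\<close>. For \<open>l \<le> j\<close>, \<open>gauss_fps_times_power_nth\<close> is
  used with \<open>p = m - l\<close>, \<open>i = j - l\<close> and the base parameters
  \<open>u + l\<close>, \<open>v + l\<close>, which reach \<open>c - a\<close> and
  \<open>c - b\<close> after adding \<open>p\<close>; for \<open>j < l\<close> both sides
  vanish.\<close>

lemma gauss_fps_transform_shift_nth:
  assumes c: "c \<notin> \<int>\<^sub>\<le>\<^sub>0" and l: "l \<le> m"
    and a: "pochhammer (c - a - of_nat m) m \<noteq> 0" and b: "pochhammer (c - b - of_nat m) m \<noteq> 0"
  shows "(-1) ^ l / (pochhammer c l * fact l)
      * fps_nth (fps_X ^ l * ((1 - fps_X) ^ (m - l) * gauss_fps (c - a) (c - b) (c + of_nat l))) j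
    = pochhammer (c - a - of_nat m) j * pochhammer (c - b - of_nat m) j / (pochhammer c j * fact j)
      * pochhammer (- of_nat j) l
      / (pochhammer (c - a - of_nat m) l * pochhammer (c - b - of_nat m) l * fact l)
      * hypergeom [- of_nat m + of_nat l, - of_nat j + of_nat l, c - a - b - of_nat m]
                  [c - a - of_nat m + of_nat l, c - b - of_nat m + of_nat l]"
proof (cases "j < l")
  case True
  hence "pochhammer (- of_nat j :: complex) l = 0"
    by (simp add: pochhammer_of_nat_eq_0_lemma)
  with True show ?thesis by (simp add: fps_X_power_mult_nth)
next
  case False
  define u v where "u = c - a - of_nat m" and "v = c - b - of_nat m"
  define p i where "p = m - l" and "i = j - l"
  have m: "m = p + l" and j: "j = l + i" using l False by (simp_all add: p_def i_def)
  have nz: "pochhammer u l \<noteq> 0" "pochhammer (u + of_nat l) p \<noteq> 0"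
    "pochhammer v l \<noteq> 0" "pochhammer (v + of_nat l) p \<noteq> 0"
    using a b by (auto simp: u_def v_def p_def pochhammer_split[OF l])
  have eqs: "u + of_nat l + of_nat p = c - a" "v + of_nat l + of_nat p = c - b"
    "- of_nat m + of_nat l = (- of_nat p :: complex)"
    "- of_nat j + of_nat l = (- of_nat i :: complex)"
    "u + of_nat l + (v + of_nat l) - (c + of_nat l) + of_nat p = c - a - b - of_nat m"
    by (simp_all add: u_def v_def m j)
  define h where "h = hypergeom [- of_nat p, - of_nat i, c - a - b - of_nat m]
    [u + of_nat l, v + of_nat l]"
  have F1: "fps_nth (fps_X ^ l * ((1 - fps_X) ^ p * gauss_fps (c - a) (c - b) (c + of_nat l))) j
    = pochhammer (u + of_nat l) i * pochhammer (v + of_nat l) i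
      / (pochhammer (c + of_nat l) i * fact i) * h"
    using gauss_fps_times_power_nth[OF add_of_nat_notin_nonpos_Ints[OF c, of l] nz(2,4), of i]
    by (simp only: eqs h_def fps_X_power_mult_nth) (simp add: j)
  have F2: "pochhammer (- of_nat j :: complex) l = (-1) ^ l * fact j / fact i"
  proof -
    have "pochhammer (- of_nat j :: complex) l = (-1) ^ l * of_nat (j choose l) * fact l"
      using pochhammer_neg_of_nat[of j l, where ?'a = complex] by (simp add: field_simps)
    thus ?thesis by (simp add: j binomial_fact)
  qed
  have F3: "pochhammer x j = pochhammer x l * pochhammer (x + of_nat l) i" for x :: complex
    using False by (simp add: i_def pochhammer_split)
  have F4: "pochhammer c l \<noteq> 0" "pochhammer (c + of_nat l) i \<noteq> 0"
    using c by (auto simp: pochhammer_nonzero add_of_nat_notin_nonpos_Ints)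
  show ?thesis
    unfolding eqs(3,4) p_def[symmetric] u_def[symmetric] v_def[symmetric] h_def[symmetric] F1 F2
      F3[of u] F3[of v] F3[of c]
    using nz F4 by (simp add: field_simps)
qed

text \<open>The values of \<open>Qhat_fun\<close> at \<open>-k\<close> stand in for the quotient in
  the zeros, so that zeros enter only at the end.\<close>

lemma euler_transformation_Qhat:
  assumes c: "c \<notin> \<int>\<^sub>\<le>\<^sub>0" and len: "length fs = length ms" and fs: "set fs \<inter> \<int>\<^sub>\<le>\<^sub>0 = {}"
    and m: "m = sum_list ms" and lam: "lam = c - a - b - of_nat m"
    and a: "pochhammer (c - a - of_nat m) m \<noteq> 0" and b: "pochhammer (c - b - of_nat m) m \<noteq> 0"
  shows "Abs_fps (\<lambda>k. pochhammer a k * pochhammer b k / (pochhammer c k * fact k)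
      * ((\<Prod>x\<leftarrow>add_params fs ms. pochhammer x k) / (\<Prod>x\<leftarrow>fs. pochhammer x k)))
    = neg_binomial_fps (- lam)
      * Abs_fps (\<lambda>k. pochhammer (a + lam) k * pochhammer (b + lam) k / (pochhammer c k * fact k)
          * Qhat_fun a b c fs ms (- of_nat k))"
    (is "?A = _ * ?B")
proof -
  define D where "D l = hypergeom (- of_nat l # add_params fs ms) fs" for l
  define K where "K l = (-1) ^ l * pochhammer a l * pochhammer b l / (pochhammer c l * fact l) * D l" for l
  define H where "H l = (1 - fps_X) ^ (m - l) * gauss_fps (c - a) (c - b) (c + of_nat l)" for l
  note nz = pochhammer_nonzero[OF c]
  have "?A = (\<Sum>l\<le>m. fps_const (K l)
      * (fps_X ^ l * gauss_fps (a + of_nat l) (b + of_nat l) (c + of_nat l)))"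
  proof (rule fps_ext)
    fix k
    \<comment> \<open>Splitting \<open>(a)_k\<close>, \<open>(b)_k\<close> and \<open>(c)_k\<close>
      at \<open>l\<close> leaves the Gauss coefficient of index \<open>k - l\<close> with shifted
      parameters; the rest is collected in \<open>K l\<close>.\<close>
    have "pochhammer a k * pochhammer b k / (pochhammer c k * fact k)
        * ((-1) ^ l * of_nat (k choose l) * D l)
      = K l * fps_nth (fps_X ^ l * gauss_fps (a + of_nat l) (b + of_nat l) (c + of_nat l)) k" for l
    proof (cases "k < l")
      case False
      hence l: "l \<le> k" by simp
      show ?thesis
        using False nz[of k] nz[of l]
        by (simp add: fps_X_power_mult_nth gauss_fps_def K_def binomial_fact[OF l]
            pochhammer_split[OF l, of a] pochhammer_split[OF l, of b] pochhammer_split[OF l, of c] mult_ac)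
    qed (simp add: fps_X_power_mult_nth binomial_eq_0)
    thus "fps_nth ?A k = fps_nth (\<Sum>l\<le>m. fps_const (K l)
        * (fps_X ^ l * gauss_fps (a + of_nat l) (b + of_nat l) (c + of_nat l))) k"
      by (simp add: hypergeom_add_params_newton[OF len fs] sum_distrib_left fps_sum_nth
          m[symmetric] D_def[symmetric])
  qed
  also have "\<dots> = neg_binomial_fps (- lam) * (\<Sum>l\<le>m. fps_const (K l) * (fps_X ^ l * H l))"
    unfolding sum_distrib_left
  proof (intro sum.cong refl)
    fix l assume "l \<in> {..m}"
    hence l: "l \<le> m" by simp
    have "- lam = a + b - c + of_nat m" by (simp add: lam)
    thus "fps_const (K l) * (fps_X ^ l * gauss_fps (a + of_nat l) (b + of_nat l) (c + of_nat l))
      = neg_binomial_fps (- lam) * (fps_const (K l) * (fps_X ^ l * H l))"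
      unfolding gauss_fps_shift_transform[OF c l] H_def by (simp only: mult_ac)
  qed
  also have "(\<Sum>l\<le>m. fps_const (K l) * (fps_X ^ l * H l)) = ?B"
  proof (rule fps_ext)
    fix j
    \<comment> \<open>The roles cross: \<open>a + lam\<close> belongs to \<open>c - b\<close> and
      \<open>b + lam\<close> to \<open>c - a\<close>.\<close>
    have ab: "a + lam = c - b - of_nat m" "b + lam = c - a - of_nat m"
      by (simp_all add: lam)
    have "K l * fps_nth (fps_X ^ l * H l) j
      = pochhammer (a + lam) j * pochhammer (b + lam) j / (pochhammer c j * fact j)
        * (D l * pochhammer a l * pochhammer b l * pochhammer (- of_nat j) l
          / (pochhammer (c - a - of_nat m) l * pochhammer (c - b - of_nat m) l * fact l)
          * hypergeom [- of_nat m + of_nat l, - of_nat j + of_nat l, c - a - b - of_nat m]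
                  [c - a - of_nat m + of_nat l, c - b - of_nat m + of_nat l])" if "l \<le> m" for l
    proof -
      have "K l * fps_nth (fps_X ^ l * H l) j = D l * pochhammer a l * pochhammer b l
          * ((-1) ^ l / (pochhammer c l * fact l) * fps_nth (fps_X ^ l * H l) j)"
        by (simp add: K_def)
      thus ?thesis
        unfolding H_def gauss_fps_transform_shift_nth[OF c that a b] ab
        by (simp add: mult_ac)
    qed
    thus "fps_nth (\<Sum>l\<le>m. fps_const (K l) * (fps_X ^ l * H l)) j = fps_nth ?B j"
      unfolding Qhat_fun_def Let_def m[symmetric] D_def[symmetric]
      by (simp add: fps_sum_nth sum_distrib_left atLeast0AtMost)
  qed
  finally show ?thesis .
qed

section \<open>Exchange of summations\<close>

text \<open>Expanding \<open>A\<close> as \<open>(1 - x)^lam B\<close> and exchanging the sums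
  leaves, for each \<open>j\<close>, a balanced sum over \<open>i = k - j\<close> with
  \<open>i \<le> n - j\<close>.\<close>

lemma saalschuetz_fps_transformation:
  assumes AB: "A = neg_binomial_fps (- lam) * B"
    and bal: "g + e + of_nat n - d + lam = 1"
    and g: "g \<notin> \<int>\<^sub>\<le>\<^sub>0" and e: "e \<notin> \<int>\<^sub>\<le>\<^sub>0"
    and gl: "g + lam \<notin> \<int>\<^sub>\<le>\<^sub>0" and el: "e + lam \<notin> \<int>\<^sub>\<le>\<^sub>0"
  shows "(\<Sum>k\<le>n. pochhammer (- of_nat n) k * pochhammer d k / (pochhammer g k * pochhammer e k)
        * fps_nth A k)
    = pochhammer (g + lam) n * pochhammer (e + lam) n / (pochhammer g n * pochhammer e n)
      * (\<Sum>k\<le>n. pochhammer (- of_nat n) k * pochhammer d k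
          / (pochhammer (g + lam) k * pochhammer (e + lam) k) * fps_nth B k)"
proof -
  define u where "u k = pochhammer (- of_nat n) k * pochhammer d k / (pochhammer g k * pochhammer e k)" for k
  note nz = pochhammer_nonzero[OF g] pochhammer_nonzero[OF e]
    pochhammer_nonzero[OF gl] pochhammer_nonzero[OF el]
  have inner: "(\<Sum>i\<le>n - j. u (j + i) * (pochhammer (- lam) i / fact i))
    = pochhammer (g + lam) n * pochhammer (e + lam) n / (pochhammer g n * pochhammer e n)
      * (pochhammer (- of_nat n) j * pochhammer d j
          / (pochhammer (g + lam) j * pochhammer (e + lam) j))" if j: "j \<le> n" for j
  proof -
    define N where "N = n - j"
    define Z where "Z = pochhammer (- of_nat n) j * pochhammer d j / (pochhammer g n * pochhammer e n)"
    have n: "n = j + N" using j by (simp add: N_def)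
    \<comment> \<open>The complements of \<open>(g)_(j+i)\<close> and \<open>(e)_(j+i)\<close> in
      \<open>(g)_n\<close> and \<open>(e)_n\<close> move into the numerator, as
      \<open>saalschuetz\<close> requires.\<close>
    have "u (j + i) * (pochhammer (- lam) i / fact i)
      = Z * ((-1) ^ i * of_nat (N choose i) * pochhammer (d + of_nat j) i * pochhammer (- lam) i
          * pochhammer (g + of_nat j + of_nat i) (N - i)
          * pochhammer (e + of_nat j + of_nat i) (N - i))" if "i \<le> N" for i
    proof -
      have ji: "j + i \<le> n" "n - (j + i) = N - i" using that by (simp_all add: n)
      have ge: "pochhammer g n = pochhammer g (j + i) * pochhammer (g + of_nat j + of_nat i) (N - i)"
        "pochhammer e n = pochhammer e (j + i) * pochhammer (e + of_nat j + of_nat i) (N - i)"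
        using pochhammer_split[OF ji(1)] ji(2) by (simp_all add: add.assoc)
      have "- of_nat n + of_nat j = (- of_nat N :: 'a)" by (simp add: n)
      hence nd: "pochhammer (- of_nat n :: 'a) (j + i)
          = pochhammer (- of_nat n) j * pochhammer (- of_nat N) i"
        "pochhammer d (j + i) = pochhammer d j * pochhammer (d + of_nat j) i"
        by (simp_all add: pochhammer_product')
      have "pochhammer (g + of_nat j + of_nat i) (N - i) \<noteq> 0"
        "pochhammer (e + of_nat j + of_nat i) (N - i) \<noteq> 0"
        using nz(1,2)[of n] unfolding ge by auto
      thus ?thesis
        unfolding pochhammer_neg_of_nat[symmetric] u_def Z_def nd ge by simp
    qed
    hence "(\<Sum>i\<le>N. u (j + i) * (pochhammer (- lam) i / fact i))
      = Z * (\<Sum>i\<le>N. (-1) ^ i * of_nat (N choose i) * pochhammer (d + of_nat j) i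
          * pochhammer (- lam) i * pochhammer (g + of_nat j + of_nat i) (N - i)
          * pochhammer (e + of_nat j + of_nat i) (N - i))"
      unfolding sum_distrib_left by (intro sum.cong) simp_all
    also have "\<dots> = Z * (pochhammer (g + lam + of_nat j) N * pochhammer (e + lam + of_nat j) N)"
    proof -
      \<comment> \<open>\<open>saalschuetz\<close> is applied with \<open>C = g + j\<close>,
        \<open>D = e + j\<close>, \<open>A = d + j\<close> and \<open>B = - lam\<close>; the last
        choice produces \<open>g + lam\<close> and \<open>e + lam\<close>.\<close>
      have "g + of_nat j + (e + of_nat j) + of_nat N = d + of_nat j + - lam + 1"
        using bal by (simp add: n algebra_simps)
      from saalschuetz[OF this] show ?thesis by (simp add: add_ac)
    qed
    finally show ?thesis
      using nz(3,4)[of j] by (simp add: Z_def N_def[symmetric] pochhammer_split[OF j, of "g + lam"]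
          pochhammer_split[OF j, of "e + lam"])
  qed
  have "(\<Sum>k\<le>n. u k * fps_nth A k)
      = (\<Sum>k\<le>n. \<Sum>j\<le>k. u k * (fps_nth B j * (pochhammer (- lam) (k - j) / fact (k - j))))"
    unfolding AB mult.commute[of "neg_binomial_fps _"]
    by (simp add: fps_mult_nth sum_distrib_left neg_binomial_fps_def atLeast0AtMost)
  also have "\<dots> = (\<Sum>j\<le>n. \<Sum>i\<le>n - j. u (j + i) * (fps_nth B j * (pochhammer (- lam) i / fact i)))"
    unfolding sum.triangle_reindex_eq[symmetric] sum.Sigma[OF finite_atMost ballI[OF finite_atMost]]
    by (rule sum.reindex_bij_witness[of _ "\<lambda>(j, i). (j + i, j)" "\<lambda>(k, j). (j, k - j)"]) auto
  also have "\<dots> = (\<Sum>j\<le>n. fps_nth B j * (\<Sum>i\<le>n - j. u (j + i) * (pochhammer (- lam) i / fact i)))"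
    by (simp add: sum_distrib_left mult_ac)
  also have "\<dots> = (\<Sum>j\<le>n. fps_nth B j
      * (pochhammer (g + lam) n * pochhammer (e + lam) n / (pochhammer g n * pochhammer e n)
        * (pochhammer (- of_nat n) j * pochhammer d j
          / (pochhammer (g + lam) j * pochhammer (e + lam) j))))"
    by (intro sum.cong refl) (simp only: inner atMost_iff)
  finally show ?thesis
    unfolding u_def by (simp add: sum_distrib_left mult_ac)
qed

section \<open>Balance conditions, zeros of \<open>Qhat\<close> and the conclusion\<close>

lemma Saalschuetzian_append_add_params:
  assumes "length fs = length ms"
  shows "Saalschuetzian (as @ add_params fs ms) (bs @ fs)
    \<longleftrightarrow> sum_list bs - sum_list as - of_nat (sum_list ms) = 1"
proof -
  have "sum_list (add_params fs ms) = sum_list fs + of_nat (sum_list ms)"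
    using assms by (induction fs ms rule: list_induct2) (simp_all add: add_params_def)
  thus ?thesis by (simp add: Saalschuetzian_def algebra_simps)
qed

text \<open>Puts the upper parameters \<open>\<zeta> + 1\<close> into the form of
  \<open>add_params\<close>, so that one balance criterion serves both sides.\<close>

lemma add_params_replicate:
  "add_params xs (replicate (length xs) 1) = map (\<lambda>z. z + 1) xs"
  by (induction xs) (simp_all add: add_params_def)

text \<open>The factor \<open>(t)_k\<close> leaves only \<open>k = 0\<close>, where each series has
  an upper parameter 0 and reduces to its first term. This normalization later removes the leading
  coefficient.\<close>

lemma Qhat_fun_0: "Qhat_fun a b c fs ms 0 = 1"
proof -
  have 1: "hypergeom (x # 0 # xs) ys = 1" for x xs ys
  proof -
    have "hypergeom (x # 0 # xs) ys = (\<Sum>k\<le>0. hypergeom_term (x # 0 # xs) ys k)"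
      by (rule hypergeom_terminating) simp
    thus ?thesis by (simp add: hypergeom_term_def o_def map_replicate_const)
  qed
  have 2: "hypergeom (0 # xs) ys = 1" for xs ys
  proof -
    have "hypergeom (0 # xs) ys = (\<Sum>k\<le>0. hypergeom_term (0 # xs) ys k)"
      by (rule hypergeom_terminating) simp
    thus ?thesis by (simp add: hypergeom_term_def o_def map_replicate_const)
  qed
  have "Qhat_fun a b c fs ms 0 = (\<Sum>k\<in>{0..sum_list ms}. if k = 0 then 1 else 0)"
    unfolding Qhat_fun_def Let_def
    by (intro sum.cong refl) (simp add: 1 2 pochhammer_0_left)
  thus ?thesis by simp
qed

text \<open>Each zero contributes \<open>(-k - z) (z)_k = -z (z + 1)_k\<close>; multiplying over all
  zeros compares \<open>p(-k)\<close> with \<open>p(0) = 1\<close>, and the leading coefficient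
  drops out.\<close>

lemma poly_ratio_proots:
  fixes p :: "complex poly"
  assumes "mset zs = proots p" "poly p 0 = 1" "set zs \<inter> \<int>\<^sub>\<le>\<^sub>0 = {}"
  shows "poly p (- of_nat k) = (\<Prod>z\<leftarrow>zs. pochhammer (z + 1) k) / (\<Prod>z\<leftarrow>zs. pochhammer z k)"
proof -
  define C where "C = lead_coeff p"
  have p: "poly p x = C * (\<Prod>z\<leftarrow>zs. x - z)" for x
  proof -
    have "poly (\<Prod>z\<leftarrow>zs. [:- z, 1:]) x = (\<Prod>z\<leftarrow>zs. x - z)"
      by (induction zs) (simp_all add: algebra_simps)
    moreover have "p = smult C (\<Prod>z\<leftarrow>zs. [:- z, 1:])"
      using complex_poly_decompose_multiset[of p]
      by (simp add: C_def assms(1)[symmetric] prod_mset_prod_list flip: mset_map)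
    ultimately show ?thesis by (metis poly_smult)
  qed
  have "(\<Prod>z\<leftarrow>zs. - of_nat k - z) * (\<Prod>z\<leftarrow>zs. pochhammer z k)
      = (\<Prod>z\<leftarrow>zs. 0 - z) * (\<Prod>z\<leftarrow>zs. pochhammer (z + 1) k)"
  proof (induction zs)
    case (Cons z zs)
    have "(- of_nat k - z) * pochhammer z k = (0 - z) * pochhammer (z + 1) k"
      using pochhammer_rec[of z k] by (simp add: pochhammer_Suc algebra_simps)
    hence "(- of_nat k - z) * pochhammer z k
        * ((\<Prod>z\<leftarrow>zs. - of_nat k - z) * (\<Prod>z\<leftarrow>zs. pochhammer z k))
      = (0 - z) * pochhammer (z + 1) k
        * ((\<Prod>z\<leftarrow>zs. 0 - z) * (\<Prod>z\<leftarrow>zs. pochhammer (z + 1) k))"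
      by (simp only: Cons.IH)
    thus ?case by (simp only: list.map prod_list.Cons mult_ac)
  qed simp
  hence "poly p (- of_nat k) * (\<Prod>z\<leftarrow>zs. pochhammer z k)
      = poly p 0 * (\<Prod>z\<leftarrow>zs. pochhammer (z + 1) k)"
    by (simp only: p mult.assoc)
  moreover have "(\<Prod>z\<leftarrow>zs. pochhammer z k) \<noteq> 0"
    using assms(3) by (auto simp: prod_list_zero_iff disjoint_iff pochhammer_nonzero)
  ultimately show ?thesis
    using assms(2) by (simp add: field_simps)
qed

theorem theorem2:
  fixes r m n :: nat and ms :: "nat list" and fs \<zeta> :: "complex list"
    and a b c d e g lam :: complex
  assumes "length fs = r" and "length ms = r" and "m = sum_list ms"
    and "lam = c - a - b - of_nat m"
    and "pochhammer (1 + a + b - c) m \<noteq> 0"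
    and "pochhammer (c - a - of_nat m) m \<noteq> 0"
    and "pochhammer (c - b - of_nat m) m \<noteq> 0"
    and "g + e + of_nat n - d + lam = 1"
    and "degree (Qhat a b c fs ms) = m"
    and "mset \<zeta> = proots (Qhat a b c fs ms)"
    and "set ([c, g, e] @ fs) \<inter> \<int>\<^sub>\<le>\<^sub>0 = {}"
    and "set ([c, g + lam, e + lam] @ \<zeta>) \<inter> \<int>\<^sub>\<le>\<^sub>0 = {}"
  shows "hypergeom ([- of_nat n, a, b, d] @ add_params fs ms) ([c, g, e] @ fs)
       = pochhammer (g + lam) n * pochhammer (e + lam) n / (pochhammer g n * pochhammer e n)
         * hypergeom ([- of_nat n, a + lam, b + lam, d] @ map (\<lambda>z. z + 1) \<zeta>)
                     ([c, g + lam, e + lam] @ \<zeta>)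
     \<and> Saalschuetzian ([- of_nat n, a, b, d] @ add_params fs ms) ([c, g, e] @ fs)
     \<and> Saalschuetzian ([- of_nat n, a + lam, b + lam, d] @ map (\<lambda>z. z + 1) \<zeta>)
                      ([c, g + lam, e + lam] @ \<zeta>)"
proof (intro conjI)
  have len: "length fs = length ms" using assms(1,2) by simp
  have nonpos: "c \<notin> \<int>\<^sub>\<le>\<^sub>0" "g \<notin> \<int>\<^sub>\<le>\<^sub>0" "e \<notin> \<int>\<^sub>\<le>\<^sub>0" "g + lam \<notin> \<int>\<^sub>\<le>\<^sub>0" "e + lam \<notin> \<int>\<^sub>\<le>\<^sub>0"
    "set fs \<inter> \<int>\<^sub>\<le>\<^sub>0 = {}" "set \<zeta> \<inter> \<int>\<^sub>\<le>\<^sub>0 = {}"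
    using assms(11,12) by auto
  \<comment> \<open>The exact degree gives \<open>m\<close> zeros, hence \<open>m\<close> unit
    shifts, matching the total shift of \<open>fs\<close>.\<close>
  have "length \<zeta> = m"
    using size_proots_complex[of "Qhat a b c fs ms"] assms(9,10) by (metis size_mset)
  hence \<zeta>: "map (\<lambda>z. z + 1) \<zeta> = add_params \<zeta> (replicate m 1)"
    "length \<zeta> = length (replicate m (1::nat))"
    using add_params_replicate[of \<zeta>] by simp_all
  \<comment> \<open>Here and in the second balance, the difference of the parameter sums is
    \<open>g + e + n - d + lam\<close>.\<close>
  show "Saalschuetzian ([- of_nat n, a, b, d] @ add_params fs ms) ([c, g, e] @ fs)"
    unfolding Saalschuetzian_append_add_params[OF len]
    using assms(8) by (simp add: assms(3,4) algebra_simps)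
  show "Saalschuetzian ([- of_nat n, a + lam, b + lam, d] @ map (\<lambda>z. z + 1) \<zeta>)
      ([c, g + lam, e + lam] @ \<zeta>)"
    unfolding \<zeta>(1) Saalschuetzian_append_add_params[OF \<zeta>(2)]
    using assms(8) by (simp add: assms(4) sum_list_replicate algebra_simps)
  have Q: "Qhat_fun a b c fs ms (- of_nat k)
      = (\<Prod>z\<leftarrow>map (\<lambda>z. z + 1) \<zeta>. pochhammer z k) / (\<Prod>z\<leftarrow>\<zeta>. pochhammer z k)" for k
    using poly_ratio_proots[OF assms(10) _ nonpos(7), of k] by (simp add: poly_Qhat Qhat_fun_0 o_def)
  show "hypergeom ([- of_nat n, a, b, d] @ add_params fs ms) ([c, g, e] @ fs)
       = pochhammer (g + lam) n * pochhammer (e + lam) n / (pochhammer g n * pochhammer e n)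
         * hypergeom ([- of_nat n, a + lam, b + lam, d] @ map (\<lambda>z. z + 1) \<zeta>)
                     ([c, g + lam, e + lam] @ \<zeta>)"
  proof -
    \<comment> \<open>Each term is split into a weight in \<open>n\<close>, \<open>d\<close>,
      \<open>g\<close>, \<open>e\<close> and a coefficient of the series related by
      \<open>euler_transformation_Qhat\<close>.\<close>
    have "hypergeom ([- of_nat n, a, b, d] @ add_params fs ms) ([c, g, e] @ fs)
      = (\<Sum>k\<le>n. pochhammer (- of_nat n) k * pochhammer d k / (pochhammer g k * pochhammer e k)
          * (pochhammer a k * pochhammer b k / (pochhammer c k * fact k)
            * ((\<Prod>x\<leftarrow>add_params fs ms. pochhammer x k) / (\<Prod>x\<leftarrow>fs. pochhammer x k))))"
      by (subst hypergeom_terminating[of n]) (simp_all add: hypergeom_term_def mult_ac)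
    moreover have "hypergeom ([- of_nat n, a + lam, b + lam, d] @ map (\<lambda>z. z + 1) \<zeta>)
        ([c, g + lam, e + lam] @ \<zeta>)
      = (\<Sum>k\<le>n. pochhammer (- of_nat n) k * pochhammer d k
          / (pochhammer (g + lam) k * pochhammer (e + lam) k)
          * (pochhammer (a + lam) k * pochhammer (b + lam) k / (pochhammer c k * fact k)
            * Qhat_fun a b c fs ms (- of_nat k)))"
      unfolding Q
      by (subst hypergeom_terminating[of n]) (simp_all add: hypergeom_term_def mult_ac)
    ultimately show ?thesis
      using saalschuetz_fps_transformation[OF
          euler_transformation_Qhat[OF nonpos(1) len nonpos(6) assms(3,4,6,7)] assms(8) nonpos(2-5)]
      by (simp only: fps_nth_Abs_fps)
  qed
qed

end
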